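(* (i) A regular $C^2$ space curve is a general helix if and only if it is a successor curve of a plane curve (and not itself a plane curve). This is equivalent to the curve having a generic Frenet apparatus whose curvature $\kappa_H$ and torsion $\tau_H$ satisfy \[ \tau_H=\cot\theta\,\kappa_H , \] where $\theta\in(0,\pi/2)$ is the slope angle. (ii) Let continuous functions $\kappa_H(s)$ and $\tau_H(s)=\cot\theta\,\kappa_H(s)$ be given, with $\theta\in(0,\pi/2)$. Let $\Omega(s)=\frac{1}{\sin\theta}\int\kappa_H(s)\,ds$ and \[ \mathbf T_H(s)=\begin{pmatrix}\sin\theta\sin\Omega(s)\\ -\sin\theta\cos\Omega(s)\\ \cos\theta\end{pmatrix},\quad \mathbf N_H(s)=\begin{pmatrix}\cos\Omega(s)\\ \sin\Omega(s)\\ 0\end{pmatrix},\quad \mathbf B_H(s)=\begin{pmatrix}-\cos\theta\sin\Omega(s)\\ \cos\theta\cos\Omega(s)\\ \sin\theta\end{pmatrix}. \] Then $(\mathbf T_H,\mathbf N_H,\mathbf B_H,\kappa_H,\tau_H)$ is a generic Frenet apparatus of a general helix. Its tangent has constant slope $\theta$, its binormal has constant slope $\pi/2-\theta$, and its principal normal image lies on a great circle. Its centrode is fixed and it has angular speed $\kappa$, where $\kappa=\kappa_H/\sin\theta$ is the curvature of the plane curve of which the helix is a successor curve.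
   Context: Curves are regular $C^2$ curves in oriented Euclidean $\mathbb R^3$, parametrized by arc length $s$ on an interval; a prime denotes $d/ds$; $\mathbf T=\mathbf x'$ is the unit tangent of $\mathbf x$. A Frenet apparatus of a curve is a tuple $(\mathbf T,\mathbf N,\mathbf B,\kappa,\tau)$ in which $(\mathbf T,\mathbf N,\mathbf B)$ is a positively oriented orthonormal frame along the curve (a Frenet frame), $\mathbf T$ is the unit tangent, $\kappa$ (signed curvature) and $\tau$ (torsion) are continuous real functions, and $\mathbf T'=\kappa\mathbf N$, $\mathbf N'=-\kappa\mathbf T+\tau\mathbf B$, $\mathbf B'=-\tau\mathbf N$. The curvature may vanish, even on intervals, so the frame need not be unique. $\mathbf N$ is called a principal normal and $\mathbf B$ a binormal. The apparatus is generic if on every interval on which $\kappa$ vanishes, $\tau$ also vanishes. The Darboux vector is $\mathbf D=\tau\mathbf T+\kappa\mathbf B$; its direction determines the frame's momentary axis of motion (the centrode), and its length $\sqrt{\kappa^2+\tau^2}$ is the angular speed. A successor curve of a unit speed $C^2$ curve $\mathbf y(s)$ with unit tangent $\mathbf t(s)$ is a curve $\mathbf x(s)$ that has $\mathbf t$ as principal normal, i.e. $\mathbf x$ has a Frenet frame $(\mathbf T,\mathbf N,\mathbf B)$ with $\mathbf N\equiv\mathbf t$. A plane curve is a curve lying on a plane. A unit vector field along a curve has constant slope $\theta$ if it makes the constant angle $\theta$ with a fixed direction. A general helix is a curve whose unit tangent makes a constant angle $\theta$ (the slope angle) with a fixed direction at every point; helices are taken to be proper, i.e. $\theta\in(0,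\pi/2)$.
   Formalization: In (i), "not itself a plane curve" excludes only plane curves other than straight lines, since lines are plane yet satisfy the definition of general helix; in (ii), the angular speed is |κ| rather than κ, since the signed curvature may be negative. *)

theory Defs
  imports "HOL-Analysis.Analysis"
begin

text \<open>
  Curves are unit speed \<open>C\<^sup>2\<close> maps on an arbitrary nondegenerate interval \<open>I\<close> (open, closed,
  half-open, bounded or not).  All derivatives are taken within \<open>I\<close>, hence one-sided at endpoints
  belonging to \<open>I\<close>.  Values outside \<open>I\<close> are irrelevant throughout.
\<close>

definition nondegenerate_interval :: "real set \<Rightarrow> bool" where
  "nondegenerate_interval I \<longleftrightarrow> is_interval I \<and> (\<exists>a\<in>I. \<exists>b\<in>I. a < b)"

definition unit_speed_C2 :: "real set \<Rightarrow> (real \<Rightarrow> real^3) \<Rightarrow> bool" where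
  "unit_speed_C2 I x \<longleftrightarrow>
     (\<exists>T A. (\<forall>s\<in>I. (x has_vector_derivative T s) (at s within I)) \<and>
            (\<forall>s\<in>I. (T has_vector_derivative A s) (at s within I)) \<and>
            continuous_on I A \<and>
            (\<forall>s\<in>I. norm (T s) = 1))"

definition unit_tangent :: "real set \<Rightarrow> (real \<Rightarrow> real^3) \<Rightarrow> real \<Rightarrow> real^3" where
  "unit_tangent I x s = vector_derivative x (at s within I)"

definition pos_orthonormal :: "real^3 \<Rightarrow> real^3 \<Rightarrow> real^3 \<Rightarrow> bool" where
  "pos_orthonormal u v w \<longleftrightarrow>
     norm u = 1 \<and> norm v = 1 \<and> norm w = 1 \<and>
     orthogonal u v \<and> orthogonal u w \<and> orthogonal v w \<and>
     det (vector [u, v, w] :: real^3^3) > 0"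

definition frenet_apparatus ::
  "real set \<Rightarrow> (real \<Rightarrow> real^3) \<Rightarrow> (real \<Rightarrow> real^3) \<Rightarrow> (real \<Rightarrow> real^3) \<Rightarrow> (real \<Rightarrow> real^3)
     \<Rightarrow> (real \<Rightarrow> real) \<Rightarrow> (real \<Rightarrow> real) \<Rightarrow> bool" where
  "frenet_apparatus I x T N B \<kappa> \<tau> \<longleftrightarrow>
     unit_speed_C2 I x \<and>
     continuous_on I \<kappa> \<and> continuous_on I \<tau> \<and>
     (\<forall>s\<in>I. T s = unit_tangent I x s \<and>
            pos_orthonormal (T s) (N s) (B s) \<and>
            (T has_vector_derivative \<kappa> s *\<^sub>R N s) (at s within I) \<and>
            (N has_vector_derivative (- \<kappa> s *\<^sub>R T s + \<tau> s *\<^sub>R B s)) (at s within I) \<and>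
            (B has_vector_derivative (- \<tau> s *\<^sub>R N s)) (at s within I))"

text \<open>Single points do not count as intervals here: \<open>\<tau>\<close> need not vanish at an isolated zero of \<open>\<kappa>\<close>.\<close>

definition generic_frenet_apparatus ::
  "real set \<Rightarrow> (real \<Rightarrow> real^3) \<Rightarrow> (real \<Rightarrow> real^3) \<Rightarrow> (real \<Rightarrow> real^3) \<Rightarrow> (real \<Rightarrow> real^3)
     \<Rightarrow> (real \<Rightarrow> real) \<Rightarrow> (real \<Rightarrow> real) \<Rightarrow> bool" where
  "generic_frenet_apparatus I x T N B \<kappa> \<tau> \<longleftrightarrow>
     frenet_apparatus I x T N B \<kappa> \<tau> \<and>
     (\<forall>J. nondegenerate_interval J \<and> J \<subseteq> I \<and> (\<forall>s\<in>J. \<kappa> s = 0) \<longrightarrow> (\<forall>s\<in>J. \<tau> s = 0))"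

definition darboux ::
  "(real \<Rightarrow> real^3) \<Rightarrow> (real \<Rightarrow> real^3) \<Rightarrow> (real \<Rightarrow> real) \<Rightarrow> (real \<Rightarrow> real) \<Rightarrow> real \<Rightarrow> real^3" where
  "darboux T B \<kappa> \<tau> s = \<tau> s *\<^sub>R T s + \<kappa> s *\<^sub>R B s"

definition angular_speed ::
  "(real \<Rightarrow> real^3) \<Rightarrow> (real \<Rightarrow> real^3) \<Rightarrow> (real \<Rightarrow> real) \<Rightarrow> (real \<Rightarrow> real) \<Rightarrow> real \<Rightarrow> real" where
  "angular_speed T B \<kappa> \<tau> s = norm (darboux T B \<kappa> \<tau> s)"

text \<open>The momentary axis is the (unoriented) line spanned by the Darboux vector; it is undefined
  at parameters where the Darboux vector vanishes.\<close>

definition fixed_centrode ::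
  "real set \<Rightarrow> (real \<Rightarrow> real^3) \<Rightarrow> (real \<Rightarrow> real^3) \<Rightarrow> (real \<Rightarrow> real) \<Rightarrow> (real \<Rightarrow> real) \<Rightarrow> bool" where
  "fixed_centrode I T B \<kappa> \<tau> \<longleftrightarrow>
     (\<exists>e. norm e = 1 \<and>
        (\<forall>s\<in>I. darboux T B \<kappa> \<tau> s \<noteq> 0 \<longrightarrow> span {darboux T B \<kappa> \<tau> s} = span {e}))"

text \<open>\<open>x\<close> is a successor curve of \<open>y\<close>.\<close>

definition successor_curve :: "real set \<Rightarrow> (real \<Rightarrow> real^3) \<Rightarrow> (real \<Rightarrow> real^3) \<Rightarrow> bool" where
  "successor_curve I y x \<longleftrightarrow>
     unit_speed_C2 I y \<and>
     (\<exists>T N B \<kappa> \<tau>. frenet_apparatus I x T N B \<kappa> \<tau> \<and> (\<forall>s\<in>I. N s = unit_tangent I y s))"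

definition plane_curve :: "real set \<Rightarrow> (real \<Rightarrow> real^3) \<Rightarrow> bool" where
  "plane_curve I x \<longleftrightarrow>
     unit_speed_C2 I x \<and> (\<exists>a b. a \<noteq> 0 \<and> x ` I \<subseteq> {p. a \<bullet> p = b})"

text \<open>Signed curvature of a plane curve whose plane is oriented by the unit normal \<open>e\<close>: the curvature
  in the Frenet apparatus with constant binormal \<open>e\<close>.\<close>

definition plane_curvature :: "real set \<Rightarrow> real^3 \<Rightarrow> (real \<Rightarrow> real^3) \<Rightarrow> (real \<Rightarrow> real) \<Rightarrow> bool" where
  "plane_curvature I e y \<kappa> \<longleftrightarrow>
     (\<exists>N. frenet_apparatus I y (unit_tangent I y) N (\<lambda>_. e) \<kappa> (\<lambda>_. 0))"

text \<open>For unit vector fields; the angle of unit vectors \<open>u\<close>, \<open>v\<close> is \<open>arccos (u \<bullet> v)\<close>.\<close>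

definition constant_slope :: "real set \<Rightarrow> (real \<Rightarrow> real^3) \<Rightarrow> real \<Rightarrow> bool" where
  "constant_slope I V \<theta> \<longleftrightarrow>
     (\<forall>s\<in>I. norm (V s) = 1) \<and>
     (\<exists>e. norm e = 1 \<and> (\<forall>s\<in>I. arccos (V s \<bullet> e) = \<theta>))"

definition helix_with_slope :: "real set \<Rightarrow> (real \<Rightarrow> real^3) \<Rightarrow> real \<Rightarrow> bool" where
  "helix_with_slope I x \<theta> \<longleftrightarrow>
     unit_speed_C2 I x \<and> 0 < \<theta> \<and> \<theta> < pi / 2 \<and> constant_slope I (unit_tangent I x) \<theta>"

definition general_helix :: "real set \<Rightarrow> (real \<Rightarrow> real^3) \<Rightarrow> bool" where
  "general_helix I x \<longleftrightarrow> (\<exists>\<theta>. helix_with_slope I x \<theta>)"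

definition great_circle :: "(real^3) set \<Rightarrow> bool" where
  "great_circle C \<longleftrightarrow> (\<exists>n. n \<noteq> 0 \<and> C = sphere 0 1 \<inter> {p. n \<bullet> p = 0})"

definition helix_T :: "real \<Rightarrow> (real \<Rightarrow> real) \<Rightarrow> real \<Rightarrow> real^3" where
  "helix_T \<theta> \<Omega> s = vector [sin \<theta> * sin (\<Omega> s), - sin \<theta> * cos (\<Omega> s), cos \<theta>]"

definition helix_N :: "(real \<Rightarrow> real) \<Rightarrow> real \<Rightarrow> real^3" where
  "helix_N \<Omega> s = vector [cos (\<Omega> s), sin (\<Omega> s), 0]"

definition helix_B :: "real \<Rightarrow> (real \<Rightarrow> real) \<Rightarrow> real \<Rightarrow> real^3" where
  "helix_B \<theta> \<Omega> s = vector [- cos \<theta> * sin (\<Omega> s), cos \<theta> * cos (\<Omega> s), sin \<theta>]"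

end

theory Submission
  imports Defs
begin

text \<open>
  Let \<open>T\<close> be the unit tangent. If \<open>T \<bullet> e = cos \<theta>\<close>, then \<open>N = e \<times> T / sin \<theta>\<close> is a \<open>C\<^sup>1\<close> principal
  normal even where the curvature vanishes, because \<open>T'\<close> is orthogonal to both \<open>T\<close> and \<open>e\<close>. Since
  \<open>N\<close> is orthogonal to \<open>e\<close>, its antiderivative is a plane curve, and \<open>e = cos \<theta> T + sin \<theta> B\<close> gives
  \<open>\<tau> = cot \<theta> \<kappa>\<close>. Conversely \<open>\<tau> = cot \<theta> \<kappa>\<close> makes \<open>cos \<theta> T + sin \<theta> B\<close> constant; and if \<open>N\<close> is
  orthogonal to a fixed \<open>a\<close>, then \<open>(T \<bullet> a)' = \<kappa> N \<bullet> a = 0\<close>, so \<open>T\<close> makes a constant angle with \<open>a\<close>.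
  This angle is right only for plane curves and zero only for straight lines.
\<close>

section \<open>Calculus on an interval\<close>

text \<open>A connected set other than a singleton has no isolated points. This makes derivatives
  within \<open>I\<close> unique, also at endpoints.\<close>

lemma at_within_nondegenerate_interval:
  assumes "nondegenerate_interval I" "s \<in> I"
  shows "at s within I \<noteq> bot"
proof -
  have "connected I" "\<And>x. I \<noteq> {x}"
    using assms(1) by (auto simp: nondegenerate_interval_def is_interval_connected)
  then show ?thesis
    using connected_imp_perfect assms(2) trivial_limit_within by blast
qed

lemma unit_tangent_eqI:
  assumes "nondegenerate_interval I" "s \<in> I" "(x has_vector_derivative v) (at s within I)"
  shows "unit_tangent I x s = v"
  unfolding unit_tangent_def
  using assms at_within_nondegenerate_interval vector_derivative_within by blast

text \<open>The fundamental theorem of calculus is applied on compact intervals, whereas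
  \<open>I\<close> may be open or unbounded. So one integral function with base point
  \<open>c\<close> is fixed, and around each \<open>s\<close> a compact subinterval is chosen that
  contains \<open>c\<close> and looks like \<open>I\<close> near \<open>s\<close>.\<close>

lemma continuous_antiderivative_on_interval:
  fixes f :: "real \<Rightarrow> 'a::euclidean_space"
  assumes I: "is_interval I" and f: "continuous_on I f"
  obtains F where "\<And>s. s \<in> I \<Longrightarrow> (F has_vector_derivative f s) (at s within I)"
proof (cases "I = {}")
  case True
  then show thesis using that by blast
next
  case False
  then obtain c where c: "c \<in> I" by blast
  define F where "F = (\<lambda>u. LBINT y=ereal c..ereal u. f y)"
  have "(F has_vector_derivative f s) (at s within I)" if s: "s \<in> I" for s
  proof -
    \<comment> \<open>The last disjunction says that \<open>a\<close> lies strictly to the left of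
      \<open>s\<close>, unless \<open>s\<close> is the least point of \<open>I\<close>;
      \<open>b\<close> is the mirror image.\<close>
    obtain a where a: "a \<in> I" "a \<le> c" "a \<le> s" "a < s \<or> (\<forall>t\<in>I. a \<le> t)"
    proof (cases "\<exists>t\<in>I. t < s")
      case True
      then obtain t where "t \<in> I" "t < s" by blast
      then show ?thesis using that[of "min t c"] c by (auto simp: min_def)
    next
      case False
      then show ?thesis using that[of s] c s by force
    qed
    obtain b where b: "b \<in> I" "c \<le> b" "s \<le> b" "s < b \<or> (\<forall>t\<in>I. t \<le> b)"
    proof (cases "\<exists>t\<in>I. s < t")
      case True
      then obtain t where "t \<in> I" "s < t" by blast
      then show ?thesis using that[of "max t c"] c by (auto simp: max_def)
    next
      case False
      then show ?thesis using that[of s] c s by force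
    qed
    have sub: "{a..b} \<subseteq> I"
      using mem_is_interval_1_I[OF I a(1) b(1)] by auto
    have F: "(F has_vector_derivative f s) (at s within {a..b})"
      unfolding F_def
      using interval_integral_FTC2[of a c b f s] a b continuous_on_subset[OF f sub] by simp
    \<comment> \<open>An open neighbourhood of \<open>s\<close> in which \<open>{a..b}\<close> and
      \<open>I\<close> coincide: it cuts off at \<open>a\<close> and \<open>b\<close> except where
      these are endpoints of \<open>I\<close> equal to \<open>s\<close>. Hence both sets give the
      same one-sided or two-sided derivative at \<open>s\<close>.\<close>
    define S where "S = {t. (a < s \<longrightarrow> a < t) \<and> (s < b \<longrightarrow> t < b)}"
    have "S = (if a < s then {a<..} else UNIV) \<inter> (if s < b then {..<b} else UNIV)"
      by (auto simp: S_def)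
    then have "open S" by (auto intro!: open_Int)
    moreover have "s \<in> S" by (simp add: S_def)
    moreover have "{a..b} \<inter> S = I \<inter> S"
      using sub a b by (force simp: S_def)
    ultimately have "at s within {a..b} = at s within I"
      by (intro at_within_nhd[of s S]) auto
    then show ?thesis using F by simp
  qed
  then show thesis using that by blast
qed

text \<open>The derivative of \<open>h (x s)\<close> is \<open>h (T s)\<close>. Planarity,
  collinearity and constant slope all say that some linear image of the curve or of its tangent is
  constant, so this one equivalence serves them all.\<close>

lemma bounded_linear_constant_iff:
  fixes h :: "'a::real_normed_vector \<Rightarrow> 'b::real_normed_vector"
  assumes I: "nondegenerate_interval I" and h: "bounded_linear h"
    and x: "\<And>s. s \<in> I \<Longrightarrow> (x has_vector_derivative T s) (at s within I)"
  shows "(\<exists>b. \<forall>s\<in>I. h (x s) = b) \<longleftrightarrow> (\<forall>s\<in>I. h (T s) = 0)"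
proof
  have d: "((\<lambda>s. h (x s)) has_vector_derivative h (T s)) (at s within I)" if "s \<in> I" for s
    using bounded_linear.has_vector_derivative[OF h x[OF that]] .
  show "\<forall>s\<in>I. h (T s) = 0" if "\<exists>b. \<forall>s\<in>I. h (x s) = b"
  proof
    fix s assume s: "s \<in> I"
    obtain b where b: "\<forall>s\<in>I. h (x s) = b" using \<open>\<exists>b. \<forall>s\<in>I. h (x s) = b\<close> by blast
    have "((\<lambda>s. h (x s)) has_vector_derivative 0) (at s within I)"
      by (rule has_vector_derivative_transform[OF s, of _ "\<lambda>_. b"]) (use b in auto)
    then show "h (T s) = 0"
      using vector_derivative_unique_within at_within_nondegenerate_interval[OF I s] d[OF s] by blast
  qed
  show "\<exists>b. \<forall>s\<in>I. h (x s) = b" if "\<forall>s\<in>I. h (T s) = 0"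
  proof -
    have "convex I" using I by (simp add: nondegenerate_interval_def is_interval_convex)
    then show ?thesis
      using has_vector_derivative_zero_constant[of I "\<lambda>s. h (x s)"] d that by metis
  qed
qed

lemma unit_speed_C2_tangent:
  assumes I: "nondegenerate_interval I" and x: "unit_speed_C2 I x"
  obtains A where "\<And>s. s \<in> I \<Longrightarrow> (x has_vector_derivative unit_tangent I x s) (at s within I)"
    "\<And>s. s \<in> I \<Longrightarrow> (unit_tangent I x has_vector_derivative A s) (at s within I)"
    "continuous_on I A" "\<And>s. s \<in> I \<Longrightarrow> norm (unit_tangent I x s) = 1"
proof -
  obtain T A where T: "\<And>s. s \<in> I \<Longrightarrow> (x has_vector_derivative T s) (at s within I)"
    and A: "\<And>s. s \<in> I \<Longrightarrow> (T has_vector_derivative A s) (at s within I)"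
      "continuous_on I A" "\<And>s. s \<in> I \<Longrightarrow> norm (T s) = 1"
    using x unfolding unit_speed_C2_def by blast
  have eq: "unit_tangent I x s = T s" if "s \<in> I" for s
    using unit_tangent_eqI[OF I that T[OF that]] .
  show thesis
    by (rule that[of A])
      (use T A eq has_vector_derivative_transform[of _ I "unit_tangent I x" T] in auto)
qed

lemma unit_tangent_properties:
  assumes "nondegenerate_interval I" "unit_speed_C2 I x"
  shows has_vector_derivative_unit_tangent:
      "\<And>s. s \<in> I \<Longrightarrow> (x has_vector_derivative unit_tangent I x s) (at s within I)"
    and norm_unit_tangent: "\<And>s. s \<in> I \<Longrightarrow> norm (unit_tangent I x s) = 1"
    and continuous_on_unit_tangent: "continuous_on I (unit_tangent I x)"
  by (rule unit_speed_C2_tangent[OF assms]; use continuous_on_vector_derivative in blast)+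

text \<open>This turns a unit field into a curve: the plane curve arises from the principal normal
  \<open>N\<close>, the explicit helix from \<open>T\<close>.\<close>

lemma unit_speed_C2_antiderivative:
  assumes I: "nondegenerate_interval I"
    and T: "\<And>s. s \<in> I \<Longrightarrow> (T has_vector_derivative A s) (at s within I)"
    and A: "continuous_on I A" and n: "\<And>s. s \<in> I \<Longrightarrow> norm (T s) = 1"
  obtains y where "unit_speed_C2 I y" "\<And>s. s \<in> I \<Longrightarrow> (y has_vector_derivative T s) (at s within I)"
    "\<And>s. s \<in> I \<Longrightarrow> unit_tangent I y s = T s"
proof -
  have "continuous_on I T"
    using T by (rule continuous_on_vector_derivative)
  moreover have "is_interval I"
    using I by (simp add: nondegenerate_interval_def)
  ultimately obtain y where y: "\<And>s. s \<in> I \<Longrightarrow> (y has_vector_derivative T s) (at s within I)"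
    using continuous_antiderivative_on_interval by blast
  moreover have "unit_speed_C2 I y"
    unfolding unit_speed_C2_def using y T A n by blast
  ultimately show thesis
    using that unit_tangent_eqI[OF I] by blast
qed

section \<open>Plane curves and straight lines\<close>

text \<open>Differentiating \<open>a \<bullet> x\<close> removes the offset \<open>b\<close> of the
  plane, which leaves a condition on the tangent alone.\<close>

lemma plane_curve_iff_tangent:
  assumes I: "nondegenerate_interval I" and x: "unit_speed_C2 I x"
  shows "plane_curve I x \<longleftrightarrow> (\<exists>a. a \<noteq> 0 \<and> (\<forall>s\<in>I. a \<bullet> unit_tangent I x s = 0))"
proof -
  have "(\<exists>b. x ` I \<subseteq> {p. a \<bullet> p = b}) \<longleftrightarrow> (\<forall>s\<in>I. a \<bullet> unit_tangent I x s = 0)" for a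
  proof -
    have "(\<exists>b. x ` I \<subseteq> {p. a \<bullet> p = b}) \<longleftrightarrow> (\<exists>b. \<forall>s\<in>I. a \<bullet> x s = b)"
      by (simp add: image_subset_iff)
    also have "\<dots> \<longleftrightarrow> (\<forall>s\<in>I. a \<bullet> unit_tangent I x s = 0)"
      by (rule bounded_linear_constant_iff[OF I bounded_linear_inner_right
            has_vector_derivative_unit_tangent[OF I x]])
    finally show ?thesis .
  qed
  then show ?thesis
    using x by (simp add: plane_curve_def)
qed

text \<open>The product \<open>T \<bullet> q\<close> is continuous, and its square is \<open>(norm q)\<^sup>2 - (norm w)\<^sup>2\<close>.\<close>

lemma unit_field_constant_if_cross_constant:
  fixes T :: "real \<Rightarrow> real^3"
  assumes "connected I" and T: "continuous_on I T" and n: "\<And>s. s \<in> I \<Longrightarrow> norm (T s) = 1"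
    and w: "\<And>s. s \<in> I \<Longrightarrow> cross3 (T s) q = w" and "q \<noteq> 0"
  shows "\<exists>c. \<forall>s\<in>I. T s = c"
proof -
  define r where "r = sqrt ((norm q)\<^sup>2 - (norm w)\<^sup>2)"
  have "T s \<bullet> q = r \<or> T s \<bullet> q = - r" if "s \<in> I" for s
  proof -
    have "(T s \<bullet> q)\<^sup>2 = (norm q)\<^sup>2 - (norm w)\<^sup>2"
      using norm_cross_dot[of "T s" q] n[OF that] w[OF that] by simp
    then have "\<bar>T s \<bullet> q\<bar> = r"
      unfolding r_def by (metis real_sqrt_abs)
    then show ?thesis by linarith
  qed
  then have "(\<lambda>s. T s \<bullet> q) ` I \<subseteq> {r, - r}"
    by blast
  then have "finite ((\<lambda>s. T s \<bullet> q) ` I)"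
    using finite_subset by blast
  moreover have "continuous_on I (\<lambda>s. T s \<bullet> q)"
    using T by (intro continuous_intros)
  ultimately have "(\<lambda>s. T s \<bullet> q) constant_on I"
    using continuous_finite_range_constant[OF \<open>connected I\<close>] by blast
  then obtain k where k: "\<And>s. s \<in> I \<Longrightarrow> T s \<bullet> q = k"
    unfolding constant_on_def by blast
  \<comment> \<open>A vector is determined by its dot and cross products with a fixed nonzero
    vector.\<close>
  have "T s = T t" if "s \<in> I" "t \<in> I" for s t
    by (rule cross_dot_cancel[OF _ _ \<open>q \<noteq> 0\<close>])
      (use that k w in \<open>metis inner_commute\<close>, use that w cross_skew in metis)
  then show ?thesis by blast
qed

text \<open>If \<open>u\<close> is the direction of the line, then the cross product of
  \<open>x\<close> with \<open>u\<close> is constant. So the tangent is everywhere parallel to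
  \<open>u\<close>, and continuity keeps it from switching between the two unit multiples of
  \<open>u\<close>.\<close>

lemma collinear_iff_tangent_constant:
  assumes I: "nondegenerate_interval I" and x: "unit_speed_C2 I x"
  shows "collinear (x ` I) \<longleftrightarrow> (\<exists>c. \<forall>s\<in>I. unit_tangent I x s = c)"
proof
  note dx = has_vector_derivative_unit_tangent[OF I x]
  note nT = norm_unit_tangent[OF I x]
  obtain s0 where s0: "s0 \<in> I"
    using I by (auto simp: nondegenerate_interval_def)
  show "\<exists>c. \<forall>s\<in>I. unit_tangent I x s = c" if line: "collinear (x ` I)"
  proof -
    obtain u where u: "\<And>s t. s \<in> I \<Longrightarrow> t \<in> I \<Longrightarrow> \<exists>c. x s - x t = c *\<^sub>R u"
      using line unfolding collinear_def by blast
    have h: "bounded_linear (\<lambda>v. cross3 v u)"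
      using bilinear_cross by (simp add: bilinear_def linear_conv_bounded_linear)
    have "cross3 (x s) u = cross3 (x s0) u" if s: "s \<in> I" for s
    proof -
      obtain c where "x s = x s0 + c *\<^sub>R u"
        using u[OF s s0] by (metis add.commute diff_add_cancel)
      then show ?thesis by (simp add: cross_add_left cross_mult_left)
    qed
    then have T: "cross3 (unit_tangent I x s) u = 0" if "s \<in> I" for s
      using bounded_linear_constant_iff[OF I h dx] that by blast
    \<comment> \<open>The definition of \<open>collinear\<close> admits \<open>u = 0\<close>; the
      curve would then be a single point, contrary to unit speed.\<close>
    have "u \<noteq> 0"
    proof
      assume "u = 0"
      then have "x s = x s0" if "s \<in> I" for s using u[OF that s0] by simp
      then have "\<exists>p. \<forall>s\<in>I. x s = p" by blast
      then have "unit_tangent I x s0 = 0"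
        using bounded_linear_constant_iff[OF I bounded_linear_ident dx] s0 by blast
      then show False using nT[OF s0] by simp
    qed
    moreover have "connected I"
      using I by (simp add: nondegenerate_interval_def is_interval_connected)
    ultimately show ?thesis
      using unit_field_constant_if_cross_constant[OF _ continuous_on_unit_tangent[OF I x] nT T]
      by blast
  qed
  show "collinear (x ` I)" if const: "\<exists>c. \<forall>s\<in>I. unit_tangent I x s = c"
  proof -
    obtain c where c: "\<And>s. s \<in> I \<Longrightarrow> unit_tangent I x s = c" using const by blast
    have "((\<lambda>s. x s - s *\<^sub>R c) has_vector_derivative 0) (at s within I)" if "s \<in> I" for s
      using dx[OF that] c[OF that] by (auto intro!: derivative_eq_intros)
    moreover have "convex I" using I by (simp add: nondegenerate_interval_def is_interval_convex)
    ultimately obtain p where p: "\<And>s. s \<in> I \<Longrightarrow> x s - s *\<^sub>R c = p"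
      using has_vector_derivative_zero_constant by blast
    have "x s = p + s *\<^sub>R c" if "s \<in> I" for s
      using p[OF that] by (simp add: algebra_simps)
    then show ?thesis
      unfolding collinear_alt by blast
  qed
qed

section \<open>Frenet apparatus\<close>

text \<open>The determinant is the squared norm of the cross product, which is 1 for orthonormal
  \<open>u\<close> and \<open>v\<close>.\<close>

lemma pos_orthonormal_cross3:
  assumes "norm u = 1" "norm v = 1" "u \<bullet> v = 0"
  shows "pos_orthonormal u v (cross3 u v)"
proof -
  have n: "(norm (cross3 u v))\<^sup>2 = 1"
    using norm_cross[of u v] assms by simp
  then have "norm (cross3 u v) = 1" by (simp add: norm_eq_1 power2_norm_eq_inner)
  moreover have "det (vector [u, v, cross3 u v] :: real^3^3) = 1"
    using n cross_triple[of u v "cross3 u v"] dot_cross_det[of u v "cross3 u v"]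
    by (simp add: power2_norm_eq_inner inner_commute)
  ultimately show ?thesis
    unfolding pos_orthonormal_def using assms
    by (auto simp: orthogonal_def dot_cross_self)
qed

text \<open>The single equation \<open>B = T \<times> N\<close> supplies the remaining orthogonality
  relations and the orientation; the second derivative \<open>\<kappa> N\<close> is continuous
  because \<open>N\<close> is differentiable.\<close>

lemma frenet_apparatusI:
  assumes I: "nondegenerate_interval I"
    and x: "\<And>s. s \<in> I \<Longrightarrow> (x has_vector_derivative T s) (at s within I)"
    and T: "\<And>s. s \<in> I \<Longrightarrow> (T has_vector_derivative \<kappa> s *\<^sub>R N s) (at s within I)"
    and N: "\<And>s. s \<in> I \<Longrightarrow> (N has_vector_derivative (- \<kappa> s *\<^sub>R T s + \<tau> s *\<^sub>R B s)) (at s within I)"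
    and B: "\<And>s. s \<in> I \<Longrightarrow> (B has_vector_derivative (- \<tau> s *\<^sub>R N s)) (at s within I)"
    and \<kappa>: "continuous_on I \<kappa>" and \<tau>: "continuous_on I \<tau>"
    and o: "\<And>s. s \<in> I \<Longrightarrow> norm (T s) = 1" "\<And>s. s \<in> I \<Longrightarrow> norm (N s) = 1"
      "\<And>s. s \<in> I \<Longrightarrow> T s \<bullet> N s = 0" "\<And>s. s \<in> I \<Longrightarrow> B s = cross3 (T s) (N s)"
  shows "frenet_apparatus I x T N B \<kappa> \<tau>"
proof -
  have "continuous_on I N"
    using N by (rule continuous_on_vector_derivative)
  then have "continuous_on I (\<lambda>s. \<kappa> s *\<^sub>R N s)"
    using \<kappa> by (intro continuous_intros)
  then have "unit_speed_C2 I x"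
    unfolding unit_speed_C2_def using x T o(1)
    by (intro exI[of _ T] exI[of _ "\<lambda>s. \<kappa> s *\<^sub>R N s"]) simp
  moreover have "\<forall>s\<in>I. T s = unit_tangent I x s"
    using unit_tangent_eqI[OF I _ x] by simp
  moreover have "\<forall>s\<in>I. pos_orthonormal (T s) (N s) (B s)"
    using pos_orthonormal_cross3 o by simp
  ultimately show ?thesis
    unfolding frenet_apparatus_def using T N B \<kappa> \<tau> by blast
qed

text \<open>By Cauchy-Schwarz the inner product of unit vectors lies in the domain where
  \<open>arccos\<close> inverts \<open>cos\<close>. The angle condition thereby becomes linear in
  the tangent and can be differentiated.\<close>

lemma helix_with_slope_iff:
  "helix_with_slope I x \<theta> \<longleftrightarrow> unit_speed_C2 I x \<and> 0 < \<theta> \<and> \<theta> < pi / 2 \<and>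
     (\<forall>s\<in>I. norm (unit_tangent I x s) = 1) \<and>
     (\<exists>e. norm e = 1 \<and> (\<forall>s\<in>I. unit_tangent I x s \<bullet> e = cos \<theta>))"
proof -
  have "arccos (v \<bullet> e) = \<theta> \<longleftrightarrow> v \<bullet> e = cos \<theta>"
    if "norm v = 1" "norm e = 1" "0 < \<theta>" "\<theta> < pi / 2" for v e :: "real^3"
  proof -
    have "\<bar>v \<bullet> e\<bar> \<le> 1" using Cauchy_Schwarz_ineq2[of v e] that by simp
    then show ?thesis using that by (auto simp: arccos_cos abs_le_iff cos_arccos_abs)
  qed
  then show ?thesis
    unfolding helix_with_slope_def constant_slope_def by blast
qed

lemma helix_frenet_apparatus:
  assumes I: "nondegenerate_interval I" and x: "unit_speed_C2 I x"
    and e: "norm e = 1" and \<theta>: "0 < \<theta>" "\<theta> < pi / 2"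
    and slope: "\<And>s. s \<in> I \<Longrightarrow> unit_tangent I x s \<bullet> e = cos \<theta>"
  obtains N B \<kappa> where
    "frenet_apparatus I x (unit_tangent I x) N B \<kappa> (\<lambda>s. cot \<theta> * \<kappa> s)" "\<And>s. e \<bullet> N s = 0"
proof -
  define T where "T = unit_tangent I x"
  obtain A where
    dx: "\<And>s. s \<in> I \<Longrightarrow> (x has_vector_derivative T s) (at s within I)" and
    dT: "\<And>s. s \<in> I \<Longrightarrow> (T has_vector_derivative A s) (at s within I)" and
    A: "continuous_on I A" and
    nT: "\<And>s. s \<in> I \<Longrightarrow> norm (T s) = 1"
    unfolding T_def using unit_speed_C2_tangent[OF I x] by blast
  have sin: "sin \<theta> > 0" using \<theta> by (intro sin_gt_zero) auto
  have Te: "T s \<bullet> e = cos \<theta>" "e \<bullet> T s = cos \<theta>" if "s \<in> I" for s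
    using slope[OF that] by (simp_all add: T_def inner_commute)
  have TT: "T s \<bullet> T s = 1" if "s \<in> I" for s
    using nT[OF that] by (simp add: norm_eq_1)
  have ee: "e \<bullet> e = 1" using e by (simp add: norm_eq_1)
  define N where "N = (\<lambda>s. (1 / sin \<theta>) *\<^sub>R cross3 e (T s))"
  \<comment> \<open>The normalized component of the axis \<open>e\<close> orthogonal to
    \<open>T\<close>; its length before normalization is \<open>sin \<theta>\<close>.\<close>
  define B where "B = (\<lambda>s. (1 / sin \<theta>) *\<^sub>R (e - cos \<theta> *\<^sub>R T s))"
  define \<kappa> where "\<kappa> = (\<lambda>s. A s \<bullet> N s)"
  have Ae: "e \<bullet> A s = 0" if "s \<in> I" for s
  proof -
    have "\<exists>b. \<forall>s\<in>I. e \<bullet> T s = b" using Te by blast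
    then show ?thesis
      using bounded_linear_constant_iff[OF I bounded_linear_inner_right dT, of e] that by blast
  qed
  have AT: "T s \<bullet> A s = 0" if s: "s \<in> I" for s
  proof -
    have "((\<lambda>s. T s \<bullet> T s) has_vector_derivative T s \<bullet> A s + A s \<bullet> T s) (at s within I)"
      using has_derivative_inner[OF dT[OF s, unfolded has_vector_derivative_def]
          dT[OF s, unfolded has_vector_derivative_def]]
      by (simp add: has_vector_derivative_def algebra_simps)
    moreover have "((\<lambda>s. T s \<bullet> T s) has_vector_derivative 0) (at s within I)"
      by (rule has_vector_derivative_transform[OF s, of _ "\<lambda>_. 1"]) (use TT in auto)
    ultimately have "T s \<bullet> A s + A s \<bullet> T s = 0"
      using vector_derivative_unique_within at_within_nondegenerate_interval[OF I s] by blast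
    then show ?thesis by (simp add: inner_commute)
  qed
  have nN: "norm (N s) = 1" if "s \<in> I" for s
  proof -
    have "(norm (cross3 e (T s)))\<^sup>2 = (sin \<theta>)\<^sup>2"
      using norm_cross[of e "T s"] nT[OF that] e Te[OF that] by (simp add: sin_squared_eq)
    then have "norm (cross3 e (T s)) = sin \<theta>"
      using sin by (simp add: power2_eq_iff_nonneg)
    then show ?thesis using sin by (simp add: N_def)
  qed
  have TN: "T s \<bullet> N s = 0" for s
    by (simp add: N_def dot_cross_self)
  have BTN: "B s = cross3 (T s) (N s)" if "s \<in> I" for s
    by (simp add: B_def N_def cross_mult_right Lagrange TT[OF that] Te[OF that])
  \<comment> \<open>As \<open>A\<close> is orthogonal to \<open>e\<close> and \<open>T\<close>, the
    Lagrange identity makes its cross product with \<open>e \<times> T\<close> vanish. So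
    \<open>A\<close> is parallel to \<open>N\<close>, and the inner product defining
    \<open>\<kappa>\<close> is the factor.\<close>
  have A_eq: "A s = \<kappa> s *\<^sub>R N s" if s: "s \<in> I" for s
  proof (rule cross_dot_cancel[of "N s"])
    have "cross3 (A s) (cross3 e (T s)) = 0"
      using Ae[OF s] AT[OF s] by (simp add: Lagrange inner_commute)
    then have "cross3 (cross3 e (T s)) (A s) = 0"
      by (metis cross_skew neg_equal_0_iff_equal)
    then show "cross3 (N s) (A s) = cross3 (N s) (\<kappa> s *\<^sub>R N s)"
      by (simp add: N_def cross_mult_left cross_mult_right)
    show "N s \<bullet> A s = N s \<bullet> \<kappa> s *\<^sub>R N s"
      using nN[OF s] by (simp add: \<kappa>_def inner_commute norm_eq_1)
    show "N s \<noteq> 0" using nN[OF s] by auto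
  qed
  have dT': "(T has_vector_derivative \<kappa> s *\<^sub>R N s) (at s within I)" if "s \<in> I" for s
    using dT[OF that] A_eq[OF that] by simp
  have "bounded_linear (cross3 e)"
    using bilinear_cross by (simp add: bilinear_def linear_conv_bounded_linear)
  then have h: "bounded_linear (\<lambda>v. (1 / sin \<theta>) *\<^sub>R cross3 e v)"
    by (rule bounded_linear_scaleR_right[THEN bounded_linear_compose])
  have dN: "(N has_vector_derivative (- \<kappa> s *\<^sub>R T s + (cot \<theta> * \<kappa> s) *\<^sub>R B s)) (at s within I)"
    if s: "s \<in> I" for s
  proof -
    have "(N has_vector_derivative (1 / sin \<theta>) *\<^sub>R cross3 e (\<kappa> s *\<^sub>R N s)) (at s within I)"
      unfolding N_def[THEN fun_cong, abs_def]
      using bounded_linear.has_vector_derivative[OF h dT'[OF s]] by (simp add: N_def)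
    \<comment> \<open>In the frame, \<open>e = cos \<theta> T + sin \<theta> B\<close>, while
      \<open>T \<times> N = B\<close> and \<open>B \<times> N = - T\<close>. The computation expands
      \<open>e \<times> (e \<times> T)\<close> and cancels \<open>sin \<theta>\<close>.\<close>
    moreover have "cross3 e (N s) = - (sin \<theta> *\<^sub>R T s) + cos \<theta> *\<^sub>R B s"
    proof -
      have p: "(cos \<theta> * cos \<theta>) *\<^sub>R T s + (sin \<theta> * sin \<theta>) *\<^sub>R T s = T s"
        by (simp flip: scaleR_add_left)
      have "sin \<theta> *\<^sub>R cross3 e (N s) = cos \<theta> *\<^sub>R e - T s"
        using sin by (simp add: N_def cross_mult_right Lagrange ee Te[OF s])
      also have "\<dots> = sin \<theta> *\<^sub>R (- (sin \<theta> *\<^sub>R T s) + cos \<theta> *\<^sub>R B s)"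
        using sin p by (simp add: B_def algebra_simps)
      finally show ?thesis using sin by (simp only: scaleR_cancel_left) simp
    qed
    ultimately show ?thesis
      using sin by (simp add: cross_mult_right cot_def algebra_simps)
  qed
  \<comment> \<open>Since \<open>e\<close> is constant, \<open>B' = - cot \<theta> T'\<close>; this
    is the origin of the torsion \<open>cot \<theta> * \<kappa>\<close>.\<close>
  have dB: "(B has_vector_derivative (- (cot \<theta> * \<kappa> s) *\<^sub>R N s)) (at s within I)" if s: "s \<in> I" for s
    unfolding B_def using dT'[OF s] sin
    by (auto intro!: derivative_eq_intros simp: cot_def)
  have "continuous_on I N"
    using dN by (rule continuous_on_vector_derivative)
  then have \<kappa>: "continuous_on I \<kappa>"
    unfolding \<kappa>_def using A by (intro continuous_intros)
  have "frenet_apparatus I x T N B \<kappa> (\<lambda>s. cot \<theta> * \<kappa> s)"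
    using \<kappa> nT nN BTN TN
    by (intro frenet_apparatusI[OF I dx dT' dN dB]) (auto intro!: continuous_intros)
  then show thesis
    using that unfolding T_def by (simp add: N_def dot_cross_self)
qed

section \<open>General helices\<close>

text \<open>Genericity is automatic for the frame of a helix, since its torsion is a constant
  multiple of its curvature. Conversely, the axis is recovered from the frame as
  \<open>cos \<theta> T + sin \<theta> B\<close>.\<close>

lemma helix_iff_generic_frenet_apparatus:
  assumes I: "nondegenerate_interval I" and \<theta>: "0 < \<theta>" "\<theta> < pi / 2"
  shows "helix_with_slope I x \<theta> \<longleftrightarrow>
    (\<exists>T N B \<kappa> \<tau>. generic_frenet_apparatus I x T N B \<kappa> \<tau> \<and> (\<forall>s\<in>I. \<tau> s = cot \<theta> * \<kappa> s))"
proof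
  assume "helix_with_slope I x \<theta>"
  then obtain e where "unit_speed_C2 I x" "norm e = 1"
    "\<And>s. s \<in> I \<Longrightarrow> unit_tangent I x s \<bullet> e = cos \<theta>"
    unfolding helix_with_slope_iff by blast
  then obtain N B \<kappa> where
    "frenet_apparatus I x (unit_tangent I x) N B \<kappa> (\<lambda>s. cot \<theta> * \<kappa> s)"
    using helix_frenet_apparatus[OF I _ _ \<theta>] by metis
  then have "generic_frenet_apparatus I x (unit_tangent I x) N B \<kappa> (\<lambda>s. cot \<theta> * \<kappa> s)"
    by (simp add: generic_frenet_apparatus_def)
  then show "\<exists>T N B \<kappa> \<tau>. generic_frenet_apparatus I x T N B \<kappa> \<tau> \<and> (\<forall>s\<in>I. \<tau> s = cot \<theta> * \<kappa> s)"
    by fastforce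
next
  assume "\<exists>T N B \<kappa> \<tau>. generic_frenet_apparatus I x T N B \<kappa> \<tau> \<and> (\<forall>s\<in>I. \<tau> s = cot \<theta> * \<kappa> s)"
  then obtain T N B \<kappa> \<tau> where G: "generic_frenet_apparatus I x T N B \<kappa> \<tau>"
    and \<tau>: "\<forall>s\<in>I. \<tau> s = cot \<theta> * \<kappa> s"
    by (elim exE conjE)
  then have F: "frenet_apparatus I x T N B \<kappa> \<tau>"
    by (simp add: generic_frenet_apparatus_def)
  have sin: "sin \<theta> > 0" using \<theta> by (intro sin_gt_zero) auto
  have T: "unit_tangent I x s = T s" if "s \<in> I" for s
    using F that by (simp add: frenet_apparatus_def)
  have o: "norm (T s) = 1" "norm (B s) = 1" "T s \<bullet> B s = 0" if "s \<in> I" for s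
    using F that by (auto simp: frenet_apparatus_def pos_orthonormal_def orthogonal_def)
  \<comment> \<open>The derivative is
    \<open>(cos \<theta> * \<kappa> - sin \<theta> * \<tau>) N\<close>, whose coefficient vanishes
    by the relation between \<open>\<tau>\<close> and \<open>\<kappa>\<close>.\<close>
  have "((\<lambda>s. cos \<theta> *\<^sub>R T s + sin \<theta> *\<^sub>R B s) has_vector_derivative 0) (at s within I)"
    if s: "s \<in> I" for s
  proof -
    have "(T has_vector_derivative \<kappa> s *\<^sub>R N s) (at s within I)"
      "(B has_vector_derivative - \<tau> s *\<^sub>R N s) (at s within I)"
      using F s by (auto simp: frenet_apparatus_def)
    then show ?thesis
      using sin \<tau> s by (auto intro!: derivative_eq_intros simp: cot_def)
  qed
  moreover have "convex I" using I by (simp add: nondegenerate_interval_def is_interval_convex)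
  ultimately obtain e where e: "\<And>s. s \<in> I \<Longrightarrow> cos \<theta> *\<^sub>R T s + sin \<theta> *\<^sub>R B s = e"
    using has_vector_derivative_zero_constant by blast
  have Te: "T s \<bullet> e = cos \<theta>" if "s \<in> I" for s
    using e[OF that, symmetric] o[OF that] by (simp add: inner_add_right norm_eq_1)
  obtain s0 where s0: "s0 \<in> I"
    using I by (auto simp: nondegenerate_interval_def)
  have "e \<bullet> e = (cos \<theta>)\<^sup>2 + (sin \<theta>)\<^sup>2"
    using o[OF s0]
    by (subst (1 2) e[OF s0, symmetric])
      (simp add: inner_add_left inner_add_right norm_eq_1 inner_commute power2_eq_square)
  then have "norm e = 1" by (simp add: norm_eq_1)
  then show "helix_with_slope I x \<theta>"
    unfolding helix_with_slope_iff using F \<theta> T Te o(1)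
    by (auto simp: frenet_apparatus_def)
qed

text \<open>The tangent lies on the unit sphere and on two nonparallel planes, given by its inner
  products with \<open>a\<close> and \<open>e\<close>. It thus has at most two values, and
  continuity selects one. In cross product form,
  \<open>T \<times> (a \<times> e) = cos \<theta> a\<close>, and
  \<open>cos \<theta> \<noteq> 0\<close> shows that the planes are not parallel.\<close>

lemma plane_helix_collinear:
  assumes I: "nondegenerate_interval I" and H: "helix_with_slope I x \<theta>" and P: "plane_curve I x"
  shows "collinear (x ` I)"
proof -
  obtain e where x: "unit_speed_C2 I x" and e: "norm e = 1" and \<theta>: "0 < \<theta>" "\<theta> < pi / 2"
    and Te: "\<And>s. s \<in> I \<Longrightarrow> unit_tangent I x s \<bullet> e = cos \<theta>"
    using H unfolding helix_with_slope_iff by blast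
  note nT = norm_unit_tangent[OF I x]
  obtain a where a: "a \<noteq> 0" "\<And>s. s \<in> I \<Longrightarrow> a \<bullet> unit_tangent I x s = 0"
    using P plane_curve_iff_tangent[OF I x] by blast
  have w: "cross3 (unit_tangent I x s) (cross3 a e) = cos \<theta> *\<^sub>R a" if "s \<in> I" for s
    using a(2)[OF that] Te[OF that] by (simp add: Lagrange inner_commute)
  obtain s0 where s0: "s0 \<in> I"
    using I by (auto simp: nondegenerate_interval_def)
  have "cos \<theta> > 0" using \<theta> by (intro cos_gt_zero_pi) auto
  then have "cross3 a e \<noteq> 0" using w[OF s0] a(1) by auto
  moreover have "connected I"
    using I by (simp add: nondegenerate_interval_def is_interval_connected)
  ultimately show ?thesis
    using unit_field_constant_if_cross_constant[OF _ continuous_on_unit_tangent[OF I x] nT w]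
      collinear_iff_tangent_constant[OF I x] by blast
qed

text \<open>If \<open>c\<close> is negative, the angle with \<open>e\<close> is obtuse; reversing
  \<open>e\<close> yields the acute slope angle \<open>arccos \<bar>c\<bar>\<close>.\<close>

lemma general_helixI:
  assumes I: "nondegenerate_interval I" and x: "unit_speed_C2 I x" and e: "norm e = 1"
    and c: "\<And>s. s \<in> I \<Longrightarrow> unit_tangent I x s \<bullet> e = c" "c \<noteq> 0" "\<bar>c\<bar> < 1"
  shows "general_helix I x"
proof -
  define \<theta> where "\<theta> = arccos \<bar>c\<bar>"
  have "cos \<theta> = \<bar>c\<bar>" using c(3) by (simp add: \<theta>_def)
  moreover have "0 < \<theta>" "\<theta> < pi / 2"
    unfolding \<theta>_def using c arccos_less_arccos[of "\<bar>c\<bar>" 1] arccos_less_arccos[of 0 "\<bar>c\<bar>"] by auto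
  moreover have "norm (sgn c *\<^sub>R e) = 1" using e c(2) by (simp add: sgn_if)
  moreover have "unit_tangent I x s \<bullet> (sgn c *\<^sub>R e) = \<bar>c\<bar>" if "s \<in> I" for s
    using c(1)[OF that] by (simp add: abs_sgn)
  ultimately have "helix_with_slope I x \<theta>"
    unfolding helix_with_slope_iff using x norm_unit_tangent[OF I x] by metis
  then show ?thesis unfolding general_helix_def by blast
qed

text \<open>A constant tangent makes a constant angle with every direction, so any direction oblique
  to it can serve as axis.\<close>

lemma line_general_helix:
  assumes I: "nondegenerate_interval I" and x: "unit_speed_C2 I x"
    and c: "\<And>s. s \<in> I \<Longrightarrow> unit_tangent I x s = c"
  shows "general_helix I x"
proof -
  obtain s0 where s0: "s0 \<in> I"
    using I by (auto simp: nondegenerate_interval_def)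
  have cc: "c \<bullet> c = 1"
    using norm_unit_tangent[OF I x s0] c[OF s0] by (simp add: norm_eq_1)
  obtain v where v: "v \<noteq> 0" "orthogonal c v"
    using orthogonal_to_vector_exists[of c] by auto
  define u where "u = sgn v"
  have uu: "u \<bullet> u = 1" "c \<bullet> u = 0"
    using v by (simp_all add: u_def norm_sgn flip: norm_eq_1) (simp add: sgn_div_norm orthogonal_def)
  \<comment> \<open>The rational point (3/5, 4/5) of the unit circle gives a unit vector whose inner
    product with \<open>c\<close> lies strictly between 0 and 1.\<close>
  define e where "e = (3/5) *\<^sub>R c + (4/5) *\<^sub>R u"
  have "norm e = 1"
    using cc uu by (simp add: norm_eq_1 e_def inner_add_left inner_add_right inner_commute)
  moreover have "c \<bullet> e = 3/5"
    using cc uu by (simp add: e_def inner_add_right)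
  ultimately show ?thesis
    using general_helixI[OF I x, of e "3/5"] c by simp
qed

text \<open>The plane curve is an antiderivative of the helix's principal normal, which is
  orthogonal to the axis. In the converse, the normal of the plane becomes the axis. The alternative
  \<open>collinear\<close> admits straight lines, which lie on planes and are nevertheless general
  helices.\<close>

lemma general_helix_iff_successor_of_plane_curve:
  assumes I: "nondegenerate_interval I" and x: "unit_speed_C2 I x"
  shows "general_helix I x \<longleftrightarrow>
    (\<exists>y. plane_curve I y \<and> successor_curve I y x) \<and> (\<not> plane_curve I x \<or> collinear (x ` I))"
proof
  assume "general_helix I x"
  then obtain \<theta> where H: "helix_with_slope I x \<theta>"
    unfolding general_helix_def by blast
  then obtain e where e: "norm e = 1" "0 < \<theta>" "\<theta> < pi / 2"
    "\<And>s. s \<in> I \<Longrightarrow> unit_tangent I x s \<bullet> e = cos \<theta>"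
    unfolding helix_with_slope_iff by blast
  obtain N B \<kappa> where F: "frenet_apparatus I x (unit_tangent I x) N B \<kappa> (\<lambda>s. cot \<theta> * \<kappa> s)"
    and eN: "\<And>s. e \<bullet> N s = 0"
    using helix_frenet_apparatus[OF I x e] by metis
  let ?A = "\<lambda>s. - \<kappa> s *\<^sub>R unit_tangent I x s + (cot \<theta> * \<kappa> s) *\<^sub>R B s"
  have dN: "(N has_vector_derivative ?A s) (at s within I)"
    and dB: "(B has_vector_derivative - (cot \<theta> * \<kappa> s) *\<^sub>R N s) (at s within I)"
    and nN: "norm (N s) = 1" if "s \<in> I" for s
    using F that by (simp_all add: frenet_apparatus_def pos_orthonormal_def)
  have "continuous_on I \<kappa>" using F by (simp add: frenet_apparatus_def)
  moreover have "continuous_on I B"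
    using dB by (rule continuous_on_vector_derivative)
  moreover note continuous_on_unit_tangent[OF I x]
  ultimately have "continuous_on I ?A" by (intro continuous_intros)
  then obtain y where y: "unit_speed_C2 I y" "\<And>s. s \<in> I \<Longrightarrow> unit_tangent I y s = N s"
    using unit_speed_C2_antiderivative[OF I dN _ nN] by metis
  have "e \<noteq> 0" using e by auto
  then have "plane_curve I y"
    using plane_curve_iff_tangent[OF I y(1)] y(2) eN by auto
  moreover have "successor_curve I y x"
    unfolding successor_curve_def using y F by metis
  moreover have "\<not> plane_curve I x \<or> collinear (x ` I)"
    using plane_helix_collinear[OF I H] by blast
  ultimately show "(\<exists>y. plane_curve I y \<and> successor_curve I y x) \<and>
      (\<not> plane_curve I x \<or> collinear (x ` I))"
    by blast
next
  assume "(\<exists>y. plane_curve I y \<and> successor_curve I y x) \<and>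
      (\<not> plane_curve I x \<or> collinear (x ` I))"
  then obtain y where y: "plane_curve I y" "successor_curve I y x"
    and P: "\<not> plane_curve I x \<or> collinear (x ` I)" by blast
  obtain T N B \<kappa> \<tau> where F: "frenet_apparatus I x T N B \<kappa> \<tau>"
    and N: "\<And>s. s \<in> I \<Longrightarrow> N s = unit_tangent I y s" and y2: "unit_speed_C2 I y"
    using y(2) unfolding successor_curve_def by blast
  obtain b where b: "b \<noteq> 0" "\<And>s. s \<in> I \<Longrightarrow> b \<bullet> N s = 0"
    using y(1) plane_curve_iff_tangent[OF I y2] N by auto
  define a where "a = sgn b"
  have a: "norm a = 1" "\<And>s. s \<in> I \<Longrightarrow> a \<bullet> N s = 0"
    using b by (auto simp: a_def norm_sgn sgn_div_norm)
  have T: "unit_tangent I x s = T s"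
    and dT: "(T has_vector_derivative \<kappa> s *\<^sub>R N s) (at s within I)" if "s \<in> I" for s
    using F that by (simp_all add: frenet_apparatus_def)
  have nT: "norm (T s) = 1" if "s \<in> I" for s
    using norm_unit_tangent[OF I x that] T[OF that] by simp
  obtain c where c: "\<And>s. s \<in> I \<Longrightarrow> a \<bullet> T s = c"
    using bounded_linear_constant_iff[OF I bounded_linear_inner_right dT, of a] a(2) by auto
  have line: "general_helix I x" if "collinear (x ` I)"
    using line_general_helix[OF I x] that collinear_iff_tangent_constant[OF I x] by blast
  show "general_helix I x"
  \<comment> \<open>Here \<open>c\<close> is the cosine of the angle between tangent and axis. If it
    is 0, the curve is plane and hence a line by \<open>P\<close>; if it is 1 or -1, the tangent is
    constant; otherwise the helix criterion applies.\<close>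
  proof (cases "c = 0")
    case True
    then have "plane_curve I x"
      using plane_curve_iff_tangent[OF I x] a(1) c T by (metis norm_zero zero_neq_one)
    then show ?thesis using P line by blast
  next
    case c0: False
    obtain s0 where s0: "s0 \<in> I"
      using I by (auto simp: nondegenerate_interval_def)
    have "\<bar>c\<bar> \<le> 1"
      using Cauchy_Schwarz_ineq2[of a "T s0"] c[OF s0] a(1) nT[OF s0] by simp
    show ?thesis
    proof (cases "\<bar>c\<bar> = 1")
      case True
      \<comment> \<open>The equality case of Cauchy-Schwarz, obtained by expanding the squared
        distance.\<close>
      have "T s = c *\<^sub>R a" if s: "s \<in> I" for s
      proof -
        have "(norm (T s - c *\<^sub>R a))\<^sup>2 = T s \<bullet> T s - 2 * c * (a \<bullet> T s) + c\<^sup>2 * (a \<bullet> a)"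
          unfolding power2_norm_eq_inner
          by (simp add: inner_diff_left inner_diff_right inner_commute power2_eq_square algebra_simps)
        also have "\<dots> = 1 - c\<^sup>2"
          using c[OF s] nT[OF s] a(1) by (simp add: norm_eq_1 power2_eq_square)
        also have "c\<^sup>2 = 1" using True by (simp add: power2_eq_1_iff abs_if split: if_splits)
        finally show ?thesis by simp
      qed
      then show ?thesis using line_general_helix[OF I x] T by simp
    next
      case False
      then show ?thesis
        using general_helixI[OF I x a(1), of c] c c0 T \<open>\<bar>c\<bar> \<le> 1\<close> by (simp add: inner_commute)
    qed
  qed
qed

section \<open>The explicit frame\<close>

text \<open>In this form a coordinate vector can be differentiated by the rules for sums and scalar
  multiples of fixed vectors.\<close>

lemma vector_3_axis: "(vector [a, b, c] :: real^3) = a *\<^sub>R axis 1 1 + b *\<^sub>R axis 2 1 + c *\<^sub>R axis 3 1"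
  by (simp add: vec_eq_iff forall_3 axis_def)

lemma has_vector_derivative_vector_3:
  assumes "(f has_real_derivative f') F" "(g has_real_derivative g') F" "(h has_real_derivative h') F"
  shows "((\<lambda>s. vector [f s, g s, h s] :: real^3) has_vector_derivative vector [f', g', h']) F"
proof -
  have "((\<lambda>s. f s *\<^sub>R v) has_vector_derivative f' *\<^sub>R v) F"
    if "(f has_real_derivative f') F" for f f' and v :: "real^3"
    using bounded_linear.has_vector_derivative[OF bounded_linear_scaleR_left] that
    by (simp add: has_real_derivative_iff_has_vector_derivative)
  then show ?thesis
    unfolding vector_3_axis using assms by (intro has_vector_derivative_add)
qed

lemma helix_frame_orthonormal:
  "norm (helix_T \<theta> \<Omega> s) = 1" "norm (helix_N \<Omega> s) = 1" "norm (helix_B \<theta> \<Omega> s) = 1"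
  "helix_T \<theta> \<Omega> s \<bullet> helix_N \<Omega> s = 0"
  "helix_B \<theta> \<Omega> s = cross3 (helix_T \<theta> \<Omega> s) (helix_N \<Omega> s)"
proof -
  have 1: "(sin t * sin u)\<^sup>2 + (sin t * cos u)\<^sup>2 + (cos t)\<^sup>2 = 1"
    "(cos t * sin u)\<^sup>2 + (cos t * cos u)\<^sup>2 + (sin t)\<^sup>2 = 1" for t u :: real
    by (simp_all add: power_mult_distrib flip: distrib_left)
  show "norm (helix_T \<theta> \<Omega> s) = 1" "norm (helix_B \<theta> \<Omega> s) = 1" "norm (helix_N \<Omega> s) = 1"
    using 1[of \<theta> "\<Omega> s", unfolded power2_eq_square]
    by (simp_all add: helix_T_def helix_B_def helix_N_def norm_eq_1 inner_vec_def sum_3)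
  show "helix_T \<theta> \<Omega> s \<bullet> helix_N \<Omega> s = 0"
    by (simp add: helix_T_def helix_N_def inner_vec_def sum_3)
  have "sin \<theta> = sin \<theta> * ((sin (\<Omega> s))\<^sup>2 + (cos (\<Omega> s))\<^sup>2)" by simp
  then have "sin \<theta> = sin \<theta> * sin (\<Omega> s) * sin (\<Omega> s) + sin \<theta> * cos (\<Omega> s) * cos (\<Omega> s)"
    by (simp only: power2_eq_square distrib_left mult.assoc)
  then show "helix_B \<theta> \<Omega> s = cross3 (helix_T \<theta> \<Omega> s) (helix_N \<Omega> s)"
    by (simp add: helix_T_def helix_B_def helix_N_def cross3_def vec_eq_iff forall_3)
qed

text \<open>With \<open>w = \<Omega>'\<close>, the frame has curvature
  \<open>sin \<theta> * w\<close> and torsion \<open>cos \<theta> * w\<close>. The derivative of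
  \<open>N\<close> is \<open>w\<close> times the horizontal vector
  \<open>(- sin \<Omega>, cos \<Omega>, 0)\<close>, which equals
  \<open>- sin \<theta> T + cos \<theta> B\<close>.\<close>

lemma helix_frame_derivatives:
  assumes \<Omega>: "(\<Omega> has_real_derivative w) (at s within I)"
  shows "(helix_T \<theta> \<Omega> has_vector_derivative (sin \<theta> * w) *\<^sub>R helix_N \<Omega> s) (at s within I)"
    and "(helix_N \<Omega> has_vector_derivative w *\<^sub>R (- sin \<theta> *\<^sub>R helix_T \<theta> \<Omega> s + cos \<theta> *\<^sub>R helix_B \<theta> \<Omega> s)) (at s within I)"
    and "(helix_B \<theta> \<Omega> has_vector_derivative - (cos \<theta> * w) *\<^sub>R helix_N \<Omega> s) (at s within I)"
proof -
  have d: "((\<lambda>s. a * sin (\<Omega> s)) has_real_derivative a * (cos (\<Omega> s) * w)) (at s within I)"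
    "((\<lambda>s. a * cos (\<Omega> s)) has_real_derivative - a * (sin (\<Omega> s) * w)) (at s within I)" for a
    using \<Omega> by (auto intro!: derivative_eq_intros)
  \<comment> \<open>The factors 1 in \<open>helix_N\<close> give its entries the shape of the rules
    \<open>d\<close>.\<close>
  have eq: "helix_T \<theta> \<Omega> = (\<lambda>s. vector [sin \<theta> * sin (\<Omega> s), - sin \<theta> * cos (\<Omega> s), cos \<theta>])"
    "helix_N \<Omega> = (\<lambda>s. vector [1 * cos (\<Omega> s), 1 * sin (\<Omega> s), 0])"
    "helix_B \<theta> \<Omega> = (\<lambda>s. vector [- cos \<theta> * sin (\<Omega> s), cos \<theta> * cos (\<Omega> s), sin \<theta>])"
    by (simp_all add: helix_T_def helix_N_def helix_B_def fun_eq_iff)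
  show "(helix_T \<theta> \<Omega> has_vector_derivative (sin \<theta> * w) *\<^sub>R helix_N \<Omega> s) (at s within I)"
    unfolding eq
    by (rule has_vector_derivative_eq_rhs[OF has_vector_derivative_vector_3[OF d(1,2) DERIV_const]])
      (simp add: vec_eq_iff forall_3)
  show "(helix_B \<theta> \<Omega> has_vector_derivative - (cos \<theta> * w) *\<^sub>R helix_N \<Omega> s) (at s within I)"
    unfolding eq
    by (rule has_vector_derivative_eq_rhs[OF has_vector_derivative_vector_3[OF d(1,2) DERIV_const]])
      (simp add: vec_eq_iff forall_3)
  have p: "w * (cos \<theta> * (cos \<theta> * u)) + w * (sin \<theta> * (sin \<theta> * u)) = w * u" for u
  proof -
    have "w * (cos \<theta> * (cos \<theta> * u)) + w * (sin \<theta> * (sin \<theta> * u)) = w * u * ((sin \<theta>)\<^sup>2 + (cos \<theta>)\<^sup>2)"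
      by (simp only: power2_eq_square) algebra
    then show ?thesis by simp
  qed
  show "(helix_N \<Omega> has_vector_derivative w *\<^sub>R (- sin \<theta> *\<^sub>R helix_T \<theta> \<Omega> s + cos \<theta> *\<^sub>R helix_B \<theta> \<Omega> s)) (at s within I)"
    unfolding eq
    by (rule has_vector_derivative_eq_rhs[OF has_vector_derivative_vector_3[OF d(2,1) DERIV_const]])
      (use p[of "sin (\<Omega> s)"] p[of "cos (\<Omega> s)"] in \<open>simp add: vec_eq_iff forall_3 algebra_simps\<close>)
qed

text \<open>This is the Darboux vector divided by the curvature: the horizontal parts of
  \<open>T\<close> and \<open>B\<close> cancel, leaving a fixed vertical vector.\<close>

lemma helix_frame_darboux:
  assumes "sin \<theta> \<noteq> 0"
  shows "cot \<theta> *\<^sub>R helix_T \<theta> \<Omega> s + helix_B \<theta> \<Omega> s = (1 / sin \<theta>) *\<^sub>R vector [0, 0, 1]"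
proof -
  have "cos \<theta> * cos \<theta> + sin \<theta> * sin \<theta> = 1" using sin_cos_squared_add3 by simp
  then show ?thesis
    using assms
    by (simp add: helix_T_def helix_B_def vec_eq_iff forall_3 cot_def field_simps)
qed

section \<open>Slopes, great circle and centrode of the explicit frame\<close>

lemma norm_axis_3: "norm (vector [0, 0, 1] :: real^3) = 1"
  by (simp add: norm_eq_1 inner_vec_def sum_3)

lemma constant_slope_helix_T:
  assumes "0 < \<theta>" "\<theta> < pi / 2"
  shows "constant_slope I (helix_T \<theta> \<Omega>) \<theta>"
proof -
  have "helix_T \<theta> \<Omega> s \<bullet> vector [0, 0, 1] = cos \<theta>" for s
    by (simp add: helix_T_def inner_vec_def sum_3)
  moreover have "arccos (cos \<theta>) = \<theta>"
    using assms by (intro arccos_cos) auto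
  ultimately show ?thesis
    unfolding constant_slope_def using helix_frame_orthonormal norm_axis_3 by metis
qed

lemma constant_slope_helix_B:
  assumes "0 < \<theta>" "\<theta> < pi / 2"
  shows "constant_slope I (helix_B \<theta> \<Omega>) (pi / 2 - \<theta>)"
proof -
  have "helix_B \<theta> \<Omega> s \<bullet> vector [0, 0, 1] = cos (pi / 2 - \<theta>)" for s
    by (simp add: helix_B_def inner_vec_def sum_3 cos_diff)
  moreover have "arccos (cos (pi / 2 - \<theta>)) = pi / 2 - \<theta>"
    using assms by (intro arccos_cos) auto
  ultimately show ?thesis
    unfolding constant_slope_def using helix_frame_orthonormal norm_axis_3 by metis
qed

lemma helix_N_great_circle: "\<exists>C. great_circle C \<and> helix_N \<Omega> ` I \<subseteq> C"
proof (intro exI conjI)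
  show "great_circle (sphere 0 1 \<inter> {p. vector [0, 0, 1] \<bullet> p = 0})"
    unfolding great_circle_def using norm_axis_3 by (metis norm_zero zero_neq_one)
  show "helix_N \<Omega> ` I \<subseteq> sphere 0 1 \<inter> {p. vector [0, 0, 1] \<bullet> p = 0}"
    by (auto simp: helix_frame_orthonormal) (simp add: helix_N_def inner_vec_def sum_3)
qed

text \<open>The Darboux vector is \<open>\<kappa> / sin \<theta>\<close> times the vertical unit
  vector. It may change sign with \<open>\<kappa>\<close>, but its span stays the same wherever it
  is nonzero, and its length is the absolute value of that factor.\<close>

lemma helix_frame_centrode:
  assumes "0 < \<theta>" "\<theta> < pi / 2" and \<tau>: "\<And>s. s \<in> I \<Longrightarrow> \<tau> s = cot \<theta> * \<kappa> s"
  shows "fixed_centrode I (helix_T \<theta> \<Omega>) (helix_B \<theta> \<Omega>) \<kappa> \<tau>"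
    and "\<And>s. s \<in> I \<Longrightarrow> angular_speed (helix_T \<theta> \<Omega>) (helix_B \<theta> \<Omega>) \<kappa> \<tau> s = \<bar>\<kappa> s / sin \<theta>\<bar>"
proof -
  let ?e = "vector [0, 0, 1] :: real^3"
  have sin: "sin \<theta> \<noteq> 0" using assms sin_gt_zero[of \<theta>] by auto
  have D: "darboux (helix_T \<theta> \<Omega>) (helix_B \<theta> \<Omega>) \<kappa> \<tau> s = (\<kappa> s / sin \<theta>) *\<^sub>R ?e" if "s \<in> I" for s
  proof -
    have "darboux (helix_T \<theta> \<Omega>) (helix_B \<theta> \<Omega>) \<kappa> \<tau> s
        = \<kappa> s *\<^sub>R (cot \<theta> *\<^sub>R helix_T \<theta> \<Omega> s + helix_B \<theta> \<Omega> s)"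
      by (simp add: darboux_def \<tau>[OF that] algebra_simps)
    then show ?thesis by (simp add: helix_frame_darboux[OF sin])
  qed
  show "fixed_centrode I (helix_T \<theta> \<Omega>) (helix_B \<theta> \<Omega>) \<kappa> \<tau>"
    unfolding fixed_centrode_def
  proof (intro exI[of _ ?e] conjI norm_axis_3 ballI impI)
    fix s assume s: "s \<in> I" and nz: "darboux (helix_T \<theta> \<Omega>) (helix_B \<theta> \<Omega>) \<kappa> \<tau> s \<noteq> 0"
    define k where "k = \<kappa> s / sin \<theta>"
    have "k \<noteq> 0" using nz D[OF s] by (auto simp: k_def)
    have "span {k *\<^sub>R ?e} = span {?e}"
    proof (rule span_eq[THEN iffD2], intro conjI)
      show "{k *\<^sub>R ?e} \<subseteq> span {?e}" by (simp add: span_mul span_base)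
      have "(1 / k) *\<^sub>R (k *\<^sub>R ?e) \<in> span {k *\<^sub>R ?e}" by (intro span_mul span_base) simp
      then show "{?e} \<subseteq> span {k *\<^sub>R ?e}" using \<open>k \<noteq> 0\<close> by simp
    qed
    then show "span {darboux (helix_T \<theta> \<Omega>) (helix_B \<theta> \<Omega>) \<kappa> \<tau> s} = span {?e}"
      by (simp add: D[OF s] k_def)
  qed
  show "angular_speed (helix_T \<theta> \<Omega>) (helix_B \<theta> \<Omega>) \<kappa> \<tau> s = \<bar>\<kappa> s / sin \<theta>\<bar>" if "s \<in> I" for s
    by (simp only: angular_speed_def D[OF that] norm_scaleR norm_axis_3 mult_1_right)
qed

text \<open>Integrating \<open>helix_T\<close> gives the helix and integrating
  \<open>helix_N\<close> gives the horizontal plane curve. The choice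
  \<open>w = \<kappa> / sin \<theta>\<close> in the frame derivatives produces curvature
  \<open>\<kappa>\<close> and torsion \<open>cot \<theta> * \<kappa>\<close>.\<close>

lemma helix_frame_curves:
  assumes I: "nondegenerate_interval I" and \<theta>: "0 < \<theta>" "\<theta> < pi / 2"
    and \<kappa>: "continuous_on I \<kappa>" and \<tau>c: "continuous_on I \<tau>" and \<tau>: "\<And>s. s \<in> I \<Longrightarrow> \<tau> s = cot \<theta> * \<kappa> s"
    and \<Omega>: "\<And>s. s \<in> I \<Longrightarrow> (\<Omega> has_real_derivative \<kappa> s / sin \<theta>) (at s within I)"
  shows "\<exists>x. generic_frenet_apparatus I x (helix_T \<theta> \<Omega>) (helix_N \<Omega>) (helix_B \<theta> \<Omega>) \<kappa> \<tau> \<and>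
    general_helix I x \<and>
    (\<exists>y. plane_curve I y \<and> successor_curve I y x \<and>
      (\<forall>s\<in>I. helix_N \<Omega> s = unit_tangent I y s) \<and>
      plane_curvature I (vector [0, 0, 1]) y (\<lambda>s. \<kappa> s / sin \<theta>))"
proof -
  let ?T = "helix_T \<theta> \<Omega>" and ?N = "helix_N \<Omega>" and ?B = "helix_B \<theta> \<Omega>"
  have sin: "sin \<theta> > 0" using \<theta> by (intro sin_gt_zero) auto
  have dT: "(?T has_vector_derivative \<kappa> s *\<^sub>R ?N s) (at s within I)" if "s \<in> I" for s
    using helix_frame_derivatives(1)[OF \<Omega>[OF that], of \<theta>] sin by simp
  have dN: "(?N has_vector_derivative - \<kappa> s *\<^sub>R ?T s + \<tau> s *\<^sub>R ?B s) (at s within I)" if "s \<in> I" for s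
    using helix_frame_derivatives(2)[OF \<Omega>[OF that], of \<theta>] sin \<tau>[OF that]
    by (simp add: cot_def algebra_simps)
  have dB: "(?B has_vector_derivative - \<tau> s *\<^sub>R ?N s) (at s within I)" if "s \<in> I" for s
    using helix_frame_derivatives(3)[OF \<Omega>[OF that], of \<theta>] sin \<tau>[OF that]
    by (simp add: cot_def)
  note c = dT[THEN continuous_on_vector_derivative] dN[THEN continuous_on_vector_derivative]
    dB[THEN continuous_on_vector_derivative]
  have "continuous_on I (\<lambda>s. \<kappa> s *\<^sub>R ?N s)"
    using c \<kappa> by (intro continuous_intros)
  then obtain x where dx: "\<And>s. s \<in> I \<Longrightarrow> (x has_vector_derivative ?T s) (at s within I)"
    using unit_speed_C2_antiderivative[OF I dT] helix_frame_orthonormal(1) by metis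
  have Fx: "frenet_apparatus I x ?T ?N ?B \<kappa> \<tau>"
    using helix_frame_orthonormal by (intro frenet_apparatusI[OF I dx dT dN dB \<kappa> \<tau>c]) auto
  moreover have "\<forall>J. nondegenerate_interval J \<and> J \<subseteq> I \<and> (\<forall>s\<in>J. \<kappa> s = 0) \<longrightarrow> (\<forall>s\<in>J. \<tau> s = 0)"
    using \<tau> by auto
  ultimately have G: "generic_frenet_apparatus I x ?T ?N ?B \<kappa> \<tau>"
    unfolding generic_frenet_apparatus_def by blast
  then have H: "general_helix I x"
    using helix_iff_generic_frenet_apparatus[OF I \<theta>] \<tau> unfolding general_helix_def by blast
  have "continuous_on I (\<lambda>s. - \<kappa> s *\<^sub>R ?T s + \<tau> s *\<^sub>R ?B s)"
    using c \<kappa> \<tau>c by (intro continuous_intros)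
  then obtain y where y: "unit_speed_C2 I y" "\<And>s. s \<in> I \<Longrightarrow> unit_tangent I y s = ?N s"
    and dy: "\<And>s. s \<in> I \<Longrightarrow> (y has_vector_derivative ?N s) (at s within I)"
    using unit_speed_C2_antiderivative[OF I dN _ helix_frame_orthonormal(2)] by metis
  have "(vector [0, 0, 1] :: real^3) \<noteq> 0" using norm_axis_3 by (metis norm_zero zero_neq_one)
  moreover have "vector [0, 0, 1] \<bullet> ?N s = 0" for s
    by (simp add: helix_N_def inner_vec_def sum_3)
  ultimately have "plane_curve I y"
    using plane_curve_iff_tangent[OF I y(1)] y(2) by metis
  moreover have "successor_curve I y x"
    unfolding successor_curve_def using y Fx by metis
  moreover have "plane_curvature I (vector [0, 0, 1]) y (\<lambda>s. \<kappa> s / sin \<theta>)"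
  proof -
    \<comment> \<open>The tangent \<open>helix_N\<close> of the plane curve turned by a quarter turn
      in its plane, so that the binormal is the vertical unit vector. The signed curvature is then
      the derivative of the turning angle \<open>\<Omega>\<close>.\<close>
    let ?M = "\<lambda>s. vector [- sin (\<Omega> s), cos (\<Omega> s), 0] :: real^3"
    have dT: "(?N has_vector_derivative (\<kappa> s / sin \<theta>) *\<^sub>R ?M s) (at s within I)" if "s \<in> I" for s
      unfolding helix_N_def[abs_def]
      by (rule has_vector_derivative_eq_rhs[OF has_vector_derivative_vector_3])
        (use \<Omega>[OF that] in \<open>auto intro!: derivative_eq_intros simp: vec_eq_iff forall_3\<close>)
    have dM: "(?M has_vector_derivative - (\<kappa> s / sin \<theta>) *\<^sub>R ?N s + 0 *\<^sub>R vector [0, 0, 1]) (at s within I)"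
      if "s \<in> I" for s
      by (rule has_vector_derivative_eq_rhs[OF has_vector_derivative_vector_3])
        (use \<Omega>[OF that] in \<open>auto intro!: derivative_eq_intros simp: vec_eq_iff forall_3 helix_N_def\<close>)
    have "frenet_apparatus I y ?N ?M (\<lambda>_. vector [0, 0, 1]) (\<lambda>s. \<kappa> s / sin \<theta>) (\<lambda>_. 0)"
    proof (rule frenet_apparatusI[OF I dy dT dM])
      show "continuous_on I (\<lambda>s. \<kappa> s / sin \<theta>)"
        using \<kappa> sin by (intro continuous_intros) auto
      show "norm (?M s) = 1" for s
        by (simp add: norm_eq_1 inner_vec_def sum_3 flip: power2_eq_square)
      show "vector [0, 0, 1] = cross3 (?N s) (?M s)" for s
        by (simp add: helix_N_def cross3_def vec_eq_iff forall_3 flip: power2_eq_square)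
    qed (auto simp: helix_frame_orthonormal, simp add: helix_N_def inner_vec_def sum_3)
    \<comment> \<open>\<open>unit_tangent I y\<close> agrees with \<open>helix_N\<close> on
      \<open>I\<close> only, so the derivative is transferred within \<open>I\<close>.\<close>
    then have "frenet_apparatus I y (unit_tangent I y) ?M (\<lambda>_. vector [0, 0, 1]) (\<lambda>s. \<kappa> s / sin \<theta>) (\<lambda>_. 0)"
      using y(2) has_vector_derivative_transform[of _ I "unit_tangent I y" ?N]
      unfolding frenet_apparatus_def by simp
    then show ?thesis unfolding plane_curvature_def by blast
  qed
  ultimately show ?thesis using G H y(2) by metis
qed

section \<open>The characterization theorem\<close>

(* Straight lines are plane curves and also satisfy the definition of a general helix, so in the
   first equivalence "not itself a plane curve" is read as "not a plane curve other than a
   straight line"; for all other curves this is literally "not a plane curve".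
   K is an arbitrary indefinite integral of kappaH.  As kappaH is signed, "angular speed kappa"
   means its absolute value. *)
theorem theorem4p1:
  fixes I :: "real set"
  assumes "nondegenerate_interval I"
  shows
    "(\<forall>x. unit_speed_C2 I x \<longrightarrow>
        (general_helix I x \<longleftrightarrow>
           (\<exists>y. plane_curve I y \<and> successor_curve I y x) \<and>
           (\<not> plane_curve I x \<or> collinear (x ` I))) \<and>
        (\<forall>\<theta>. 0 < \<theta> \<and> \<theta> < pi / 2 \<longrightarrow>
           (helix_with_slope I x \<theta> \<longleftrightarrow>
              (\<exists>T N B \<kappa>H \<tau>H. generic_frenet_apparatus I x T N B \<kappa>H \<tau>H \<and>
                 (\<forall>s\<in>I. \<tau>H s = cot \<theta> * \<kappa>H s)))))
     \<and>
     (\<forall>\<theta> \<kappa>H \<tau>H K \<Omega> TH NH BH \<kappa>.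
        0 < \<theta> \<and> \<theta> < pi / 2 \<and>
        continuous_on I \<kappa>H \<and> continuous_on I \<tau>H \<and>
        (\<forall>s\<in>I. \<tau>H s = cot \<theta> * \<kappa>H s) \<and>
        (\<forall>s\<in>I. (K has_real_derivative \<kappa>H s) (at s within I)) \<and>
        \<Omega> = (\<lambda>s. 1 / sin \<theta> * K s) \<and>
        TH = helix_T \<theta> \<Omega> \<and> NH = helix_N \<Omega> \<and> BH = helix_B \<theta> \<Omega> \<and>
        \<kappa> = (\<lambda>s. \<kappa>H s / sin \<theta>) \<longrightarrow>
        (\<exists>x. generic_frenet_apparatus I x TH NH BH \<kappa>H \<tau>H \<and> general_helix I x \<and>
           (\<exists>y. plane_curve I y \<and> successor_curve I y x \<and>
              (\<forall>s\<in>I. NH s = unit_tangent I y s) \<and>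
              plane_curvature I (vector [0, 0, 1]) y \<kappa>)) \<and>
        constant_slope I TH \<theta> \<and>
        constant_slope I BH (pi / 2 - \<theta>) \<and>
        (\<exists>C. great_circle C \<and> NH ` I \<subseteq> C) \<and>
        fixed_centrode I TH BH \<kappa>H \<tau>H \<and>
        (\<forall>s\<in>I. angular_speed TH BH \<kappa>H \<tau>H s = \<bar>\<kappa> s\<bar>))"
proof -
  show ?thesis
  \<comment> \<open>Cases 1 and 2 are the two equivalences, case 3 is the existence of the helix and
    its plane curve, and cases 4 to 8 are the properties of the explicit frame.\<close>
  proof (intro conjI allI impI, goal_cases)
    case (1 x)
    then show ?case by (rule general_helix_iff_successor_of_plane_curve[OF assms])
  next
    case (2 x \<theta>)
    then show ?case using helix_iff_generic_frenet_apparatus[OF assms] by blast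
  next
    case (3 \<theta> \<kappa>H \<tau>H K \<Omega> TH NH BH \<kappa>)
    moreover have "sin \<theta> \<noteq> 0" using 3 sin_gt_zero[of \<theta>] by auto
    ultimately have "(\<Omega> has_real_derivative \<kappa>H s / sin \<theta>) (at s within I)" if "s \<in> I" for s
      using that by (auto intro!: derivative_eq_intros)
    with 3 show ?case
      using helix_frame_curves[OF assms, of \<theta> \<kappa>H \<tau>H \<Omega>] 3 by blast
  next
    case (4 \<theta> \<kappa>H \<tau>H K \<Omega> TH NH BH \<kappa>)
    then show ?case using constant_slope_helix_T by blast
  next
    case (5 \<theta> \<kappa>H \<tau>H K \<Omega> TH NH BH \<kappa>)
    then show ?case using constant_slope_helix_B by blast
  next
    case (6 \<theta> \<kappa>H \<tau>H K \<Omega> TH NH BH \<kappa>)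
    then show ?case using helix_N_great_circle by blast
  next
    case (7 \<theta> \<kappa>H \<tau>H K \<Omega> TH NH BH \<kappa>)
    then show ?case using helix_frame_centrode(1)[of \<theta> I \<tau>H \<kappa>H \<Omega>] by blast
  next
    case (8 \<theta> \<kappa>H \<tau>H K \<Omega> TH NH BH \<kappa>)
    then show ?case using helix_frame_centrode(2)[of \<theta> I \<tau>H \<kappa>H _ \<Omega>] by simp
  qed
qed

end
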